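(* Let $P:\mathcal{C}^{\mathrm{op}}\to\mathbf{Pos}$ be a Gödel doctrine. Then for all objects $I,U,X,V,Y$ of $\mathcal{C}$ and all quantifier-free predicates $\psi_D\in P(I\times U\times X)$ and $\phi_D\in P(I\times V\times Y)$ of $P$ we have $$i:I\mid \exists u:U.\,\forall x:X.\,\psi_D(i,u,x)\ \vdash\ \exists v:V.\,\forall y:Y.\,\phi_D(i,v,y)$$ if and only if there exist arrows $f_0:I\times U\to V$ and $f_1:I\times U\times Y\to X$ of $\mathcal{C}$ such that $$i:I,\ u:U,\ y:Y\mid \psi_D(i,u,f_1(i,u,y))\ \vdash\ \phi_D(i,f_0(i,u),y).$$
   Context: A doctrine is a functor $P:\mathcal{C}^{\mathrm{op}}\to\mathbf{Pos}$, where $\mathcal{C}$ has finite products and $\mathbf{Pos}$ is the category of posets and monotone maps. For $f:A\to B$ in $\mathcal{C}$ write $P_f:P(B)\to P(A)$. Elements of $P(A)$ are called predicates. $P$ is existential (resp. universal) if for every product projection $\pi_i:A_1\times A_2\to A_i$ the map $P_{\pi_i}$ has a left adjoint $\exists_{\pi_i}$ (resp. a right adjoint $\forall_{\pi_i}$) and the Beck-Chevalley condition holds: for every pullback square $\pi f'=f\pi'$ with $\pi:X\to A$ and $\pi':X'\to A'$ projections, $f:A'\to A$, $f':X'\to X$, and every $\beta\in P(X)$, $\exists_{\pi'}P_{f'}\beta=P_f\exists_\pi\beta$ (resp. $\forall_{\pi'}P_{f'}\beta=P_f\forall_\pi\beta$). Internal language: $a:A\mid\phi(a)\vdash\psi(a)$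 means $\phi\le\psi$ in $P(A)$ (a context with several variables denotes the product of the types); $\dashv\vdash$ means both inequalities. For $\alpha\in P(A\times B)$, $\exists b:B.\,\alpha(a,b)$ and $\forall b:B.\,\alpha(a,b)$ denote $\exists_{\pi_A}\alpha$ and $\forall_{\pi_A}\alpha$ in $P(A)$, with $\pi_A:A\times B\to A$ the projection. Terms are arrows of $\mathcal{C}$ and substitution is reindexing, e.g. $\alpha(a,g(a))$ is $P_{\langle 1_A,g\rangle}\alpha$. Let $P$ be existential. $\alpha\in P(A)$ is an existential splitting if for every object $B$ and every $\beta\in P(A\times B)$ with $\alpha(a)\vdash\exists b:B.\,\beta(a,b)$ there is $g:A\to B$ with $\alpha(a)\vdash\beta(a,g(a))$. $\alpha\in P(I)$ is existential-free if $P_f(\alpha)$ is an existential splitting for every arrow $f:A\to I$. $P$ has enough existential-free predicates if for every $I$ and $\alpha\in P(I)$ there are an object $A$ and an existential-free $\beta\in P(I\times A)$ with $\alpha=\exists_{\pi_I}\beta$. $P^{\exists\text{-free}}$ denotes the subdoctrine of $P$ (same base) whose fibre over $A$ is the set of existential-free elements of $P(A)$ with the induced order. Dually, for $P$ universal, $\alpha\in P(A)$ is a universal splitting if for every $B$ and every $\beta\in P(A\times B)$ with $\forall b:B.\,\beta(a,b)\vdash\alpha(a)$ there is $g:A\to B$ with $\beta(a,g(a))\vdash\alpha(a)$. $\alpha\in P(I)$ is universal-free if $P_f(\alpha)$ is a universal splitting for every $f:A\to I$. $P$ has enough universal-free predicates if for every $I$ and $\alpha\in P(I)$ there are $A$ and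 a universal-free $\beta\in P(I\times A)$ with $\alpha=\forall_{\pi_I}\beta$. $P$ is a Skolem doctrine if: (i) $\mathcal{C}$ is cartesian closed; (ii) $P$ is existential and universal; (iii) $P$ has enough existential-free predicates; (iv) if $\alpha\in P(A)$ is existential-free then $\forall_\pi(\alpha)$ is existential-free for every projection $\pi$ from $A$ (so $P^{\exists\text{-free}}$ is a universal doctrine, with universal quantifiers those of $P$). $P$ is a Gödel doctrine if it is a Skolem doctrine and the doctrine $P^{\exists\text{-free}}$ has enough universal-free predicates. A predicate of a Gödel doctrine $P$ is quantifier-free if it is existential-free in $P$ and universal-free in the doctrine $P^{\exists\text{-free}}$ (universal-freeness being tested only against $\beta$ in $P^{\exists\text{-free}}$). *)

theory Defs
  imports Main
begin

section \<open>Categories with finite products\<close>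

record ('o, 'm) category =
  Obj :: "'o set"
  Arr :: "'m set"
  Dom :: "'m \<Rightarrow> 'o"
  Cod :: "'m \<Rightarrow> 'o"
  Idn :: "'o \<Rightarrow> 'm"
  Comp :: "'m \<Rightarrow> 'm \<Rightarrow> 'm"  (infixl "\<cdot>\<index>" 75)

definition hom :: "('o, 'm, 'c) category_scheme \<Rightarrow> 'o \<Rightarrow> 'o \<Rightarrow> 'm set" where
  "hom C A B = {f \<in> Arr C. Dom C f = A \<and> Cod C f = B}"

locale category =
  fixes C :: "('o, 'm, 'c) category_scheme" (structure)
  assumes dom_in_obj: "f \<in> Arr C \<Longrightarrow> Dom C f \<in> Obj C"
    and cod_in_obj: "f \<in> Arr C \<Longrightarrow> Cod C f \<in> Obj C"
    and id_in_hom: "A \<in> Obj C \<Longrightarrow> Idn C A \<in> hom C A A"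
    and comp_in_hom: "\<lbrakk>f \<in> hom C A B; g \<in> hom C B D\<rbrakk> \<Longrightarrow> g \<cdot> f \<in> hom C A D"
    and comp_id_left: "f \<in> hom C A B \<Longrightarrow> Idn C B \<cdot> f = f"
    and comp_id_right: "f \<in> hom C A B \<Longrightarrow> f \<cdot> Idn C A = f"
    and comp_assoc: "\<lbrakk>f \<in> hom C A B; g \<in> hom C B D; h \<in> hom C D E\<rbrakk>
      \<Longrightarrow> (h \<cdot> g) \<cdot> f = h \<cdot> (g \<cdot> f)"

definition is_terminal :: "('o, 'm, 'c) category_scheme \<Rightarrow> 'o \<Rightarrow> bool" where
  "is_terminal C T \<longleftrightarrow> T \<in> Obj C \<and> (\<forall>A\<in>Obj C. \<exists>!h. h \<in> hom C A T)"

definition is_product :: "('o, 'm, 'c) category_scheme \<Rightarrow> 'm \<Rightarrow> 'm \<Rightarrow> bool" where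
  "is_product C p q \<longleftrightarrow>
     p \<in> Arr C \<and> q \<in> Arr C \<and> Dom C p = Dom C q \<and>
     (\<forall>Z\<in>Obj C. \<forall>h\<in>hom C Z (Cod C p). \<forall>k\<in>hom C Z (Cod C q).
        \<exists>!m. m \<in> hom C Z (Dom C p) \<and> p \<cdot>\<^bsub>C\<^esub> m = h \<and> q \<cdot>\<^bsub>C\<^esub> m = k)"

text \<open>A projection is a leg of any binary product cone, not only of a chosen one; by symmetry of
  the notion of product this covers both legs.\<close>

definition is_projection :: "('o, 'm, 'c) category_scheme \<Rightarrow> 'm \<Rightarrow> bool" where
  "is_projection C p \<longleftrightarrow> (\<exists>q. is_product C p q)"

text \<open>\<open>is_pullback C f g p q\<close>: the square \<open>f \<cdot> p = g \<cdot> q\<close> is a pullback.\<close>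

definition is_pullback :: "('o, 'm, 'c) category_scheme \<Rightarrow> 'm \<Rightarrow> 'm \<Rightarrow> 'm \<Rightarrow> 'm \<Rightarrow> bool" where
  "is_pullback C f g p q \<longleftrightarrow>
     f \<in> Arr C \<and> g \<in> Arr C \<and> p \<in> Arr C \<and> q \<in> Arr C \<and>
     Cod C f = Cod C g \<and> Dom C p = Dom C q \<and> Cod C p = Dom C f \<and> Cod C q = Dom C g \<and>
     f \<cdot>\<^bsub>C\<^esub> p = g \<cdot>\<^bsub>C\<^esub> q \<and>
     (\<forall>Z\<in>Obj C. \<forall>h\<in>hom C Z (Dom C f). \<forall>k\<in>hom C Z (Dom C g). f \<cdot>\<^bsub>C\<^esub> h = g \<cdot>\<^bsub>C\<^esub> k \<longrightarrow>
        (\<exists>!m. m \<in> hom C Z (Dom C p) \<and> p \<cdot>\<^bsub>C\<^esub> m = h \<and> q \<cdot>\<^bsub>C\<^esub> m = k))"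

text \<open>Binary products are part of the structure, as an arbitrary choice, so that \<open>A \<otimes> B\<close> denotes
  an object. The choice associates to the left: \<open>I \<otimes> U \<otimes> X = (I \<otimes> U) \<otimes> X\<close>.\<close>

record ('o, 'm) fp_category = "('o, 'm) category" +
  Prod :: "'o \<Rightarrow> 'o \<Rightarrow> 'o"  (infixl "\<otimes>\<index>" 80)
  Pr1 :: "'o \<Rightarrow> 'o \<Rightarrow> 'm"
  Pr2 :: "'o \<Rightarrow> 'o \<Rightarrow> 'm"

locale fp_category = category C
  for C :: "('o, 'm, 'c) fp_category_scheme" (structure) +
  assumes has_terminal: "\<exists>T. is_terminal C T"
    and prod_in_obj: "\<lbrakk>A \<in> Obj C; B \<in> Obj C\<rbrakk> \<Longrightarrow> A \<otimes> B \<in> Obj C"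
    and pr1_in_hom: "\<lbrakk>A \<in> Obj C; B \<in> Obj C\<rbrakk> \<Longrightarrow> Pr1 C A B \<in> hom C (A \<otimes> B) A"
    and pr2_in_hom: "\<lbrakk>A \<in> Obj C; B \<in> Obj C\<rbrakk> \<Longrightarrow> Pr2 C A B \<in> hom C (A \<otimes> B) B"
    and is_product_pr: "\<lbrakk>A \<in> Obj C; B \<in> Obj C\<rbrakk> \<Longrightarrow> is_product C (Pr1 C A B) (Pr2 C A B)"

definition pair :: "('o, 'm, 'c) fp_category_scheme \<Rightarrow> 'm \<Rightarrow> 'm \<Rightarrow> 'm"  ("\<langle>_,/ _\<rangle>\<index>") where
  "\<langle>f, g\<rangle>\<^bsub>C\<^esub> = (THE h. h \<in> hom C (Dom C f) (Cod C f \<otimes>\<^bsub>C\<^esub> Cod C g) \<and>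
     Pr1 C (Cod C f) (Cod C g) \<cdot>\<^bsub>C\<^esub> h = f \<and> Pr2 C (Cod C f) (Cod C g) \<cdot>\<^bsub>C\<^esub> h = g)"

definition is_exponential :: "('o, 'm, 'c) fp_category_scheme \<Rightarrow> 'o \<Rightarrow> 'o \<Rightarrow> 'o \<Rightarrow> 'm \<Rightarrow> bool" where
  "is_exponential C A B E ev \<longleftrightarrow>
     E \<in> Obj C \<and> ev \<in> hom C (E \<otimes>\<^bsub>C\<^esub> A) B \<and>
     (\<forall>Z\<in>Obj C. \<forall>g\<in>hom C (Z \<otimes>\<^bsub>C\<^esub> A) B.
        \<exists>!h. h \<in> hom C Z E \<and> ev \<cdot>\<^bsub>C\<^esub> \<langle>h \<cdot>\<^bsub>C\<^esub> Pr1 C Z A, Pr2 C Z A\<rangle>\<^bsub>C\<^esub> = g)"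

definition cartesian_closed :: "('o, 'm, 'c) fp_category_scheme \<Rightarrow> bool" where
  "cartesian_closed C \<longleftrightarrow>
     fp_category C \<and> (\<forall>A\<in>Obj C. \<forall>B\<in>Obj C. \<exists>E ev. is_exponential C A B E ev)"


section \<open>Doctrines\<close>

text \<open>\<open>Fib P A\<close> and \<open>Le P A\<close> are the carrier and the order of the poset \<open>P(A)\<close>, and \<open>Re P f\<close> is
  the reindexing map \<open>P\<^sub>f\<close>. All fibres live in one type \<open>'p\<close>; fibres over different objects may
  overlap and are not related to each other.\<close>

record ('o, 'm, 'p) doctrine =
  Fib :: "'o \<Rightarrow> 'p set"
  Le :: "'o \<Rightarrow> 'p \<Rightarrow> 'p \<Rightarrow> bool"
  Re :: "'m \<Rightarrow> 'p \<Rightarrow> 'p"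

locale doctrine = fp_category C
  for C :: "('o, 'm, 'c) fp_category_scheme" (structure)
    and P :: "('o, 'm, 'p, 'd) doctrine_scheme" +
  assumes le_refl: "\<lbrakk>A \<in> Obj C; \<alpha> \<in> Fib P A\<rbrakk> \<Longrightarrow> Le P A \<alpha> \<alpha>"
    and le_antisym: "\<lbrakk>A \<in> Obj C; \<alpha> \<in> Fib P A; \<beta> \<in> Fib P A; Le P A \<alpha> \<beta>; Le P A \<beta> \<alpha>\<rbrakk> \<Longrightarrow> \<alpha> = \<beta>"
    and le_trans: "\<lbrakk>A \<in> Obj C; \<alpha> \<in> Fib P A; \<beta> \<in> Fib P A; \<gamma> \<in> Fib P A; Le P A \<alpha> \<beta>; Le P A \<beta> \<gamma>\<rbrakk>
      \<Longrightarrow> Le P A \<alpha> \<gamma>"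
    and re_in_fib: "\<lbrakk>f \<in> hom C A B; \<beta> \<in> Fib P B\<rbrakk> \<Longrightarrow> Re P f \<beta> \<in> Fib P A"
    and re_mono: "\<lbrakk>f \<in> hom C A B; \<beta> \<in> Fib P B; \<gamma> \<in> Fib P B; Le P B \<beta> \<gamma>\<rbrakk>
      \<Longrightarrow> Le P A (Re P f \<beta>) (Re P f \<gamma>)"
    and re_id: "\<lbrakk>A \<in> Obj C; \<alpha> \<in> Fib P A\<rbrakk> \<Longrightarrow> Re P (Idn C A) \<alpha> = \<alpha>"
    and re_comp: "\<lbrakk>f \<in> hom C A B; g \<in> hom C B D; \<delta> \<in> Fib P D\<rbrakk>
      \<Longrightarrow> Re P (g \<cdot> f) \<delta> = Re P f (Re P g \<delta>)"

text \<open>Monotonicity of the adjoints below is a consequence of the adjunction.\<close>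

definition is_left_adjoint ::
  "('o, 'm, 'c) category_scheme \<Rightarrow> ('o, 'm, 'p, 'd) doctrine_scheme \<Rightarrow> 'm \<Rightarrow> ('p \<Rightarrow> 'p) \<Rightarrow> bool" where
  "is_left_adjoint C P p L \<longleftrightarrow>
     (\<forall>\<alpha>\<in>Fib P (Dom C p). L \<alpha> \<in> Fib P (Cod C p) \<and>
       (\<forall>\<beta>\<in>Fib P (Cod C p). Le P (Cod C p) (L \<alpha>) \<beta> \<longleftrightarrow> Le P (Dom C p) \<alpha> (Re P p \<beta>)))"

definition is_right_adjoint ::
  "('o, 'm, 'c) category_scheme \<Rightarrow> ('o, 'm, 'p, 'd) doctrine_scheme \<Rightarrow> 'm \<Rightarrow> ('p \<Rightarrow> 'p) \<Rightarrow> bool" where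
  "is_right_adjoint C P p R \<longleftrightarrow>
     (\<forall>\<alpha>\<in>Fib P (Dom C p). R \<alpha> \<in> Fib P (Cod C p) \<and>
       (\<forall>\<beta>\<in>Fib P (Cod C p). Le P (Cod C p) \<beta> (R \<alpha>) \<longleftrightarrow> Le P (Dom C p) (Re P p \<beta>) \<alpha>))"

text \<open>\<open>\<exists>\<^sub>p \<alpha>\<close> and \<open>\<forall>\<^sub>p \<alpha>\<close>. An adjoint, if it exists, is determined only on the carrier of its
  domain fibre; hence the description operator is applied to its value at \<open>\<alpha>\<close>.\<close>

definition exq ::
  "('o, 'm, 'c) category_scheme \<Rightarrow> ('o, 'm, 'p, 'd) doctrine_scheme \<Rightarrow> 'm \<Rightarrow> 'p \<Rightarrow> 'p" where
  "exq C P p \<alpha> = (THE \<gamma>. \<exists>L. is_left_adjoint C P p L \<and> \<gamma> = L \<alpha>)"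

definition allq ::
  "('o, 'm, 'c) category_scheme \<Rightarrow> ('o, 'm, 'p, 'd) doctrine_scheme \<Rightarrow> 'm \<Rightarrow> 'p \<Rightarrow> 'p" where
  "allq C P p \<alpha> = (THE \<gamma>. \<exists>R. is_right_adjoint C P p R \<and> \<gamma> = R \<alpha>)"

definition existential ::
  "('o, 'm, 'c) category_scheme \<Rightarrow> ('o, 'm, 'p, 'd) doctrine_scheme \<Rightarrow> bool" where
  "existential C P \<longleftrightarrow>
     (\<forall>p. is_projection C p \<longrightarrow> (\<exists>L. is_left_adjoint C P p L)) \<and>
     (\<forall>p f p' f'. is_projection C p \<and> is_projection C p' \<and> is_pullback C p f f' p' \<longrightarrow>
        (\<forall>\<beta>\<in>Fib P (Dom C p). exq C P p' (Re P f' \<beta>) = Re P f (exq C P p \<beta>)))"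

definition universal ::
  "('o, 'm, 'c) category_scheme \<Rightarrow> ('o, 'm, 'p, 'd) doctrine_scheme \<Rightarrow> bool" where
  "universal C P \<longleftrightarrow>
     (\<forall>p. is_projection C p \<longrightarrow> (\<exists>R. is_right_adjoint C P p R)) \<and>
     (\<forall>p f p' f'. is_projection C p \<and> is_projection C p' \<and> is_pullback C p f f' p' \<longrightarrow>
        (\<forall>\<beta>\<in>Fib P (Dom C p). allq C P p' (Re P f' \<beta>) = Re P f (allq C P p \<beta>)))"


section \<open>Quantifier-free predicates, Skolem and Goedel doctrines\<close>

definition existential_splitting ::
  "('o, 'm, 'c) fp_category_scheme \<Rightarrow> ('o, 'm, 'p, 'd) doctrine_scheme \<Rightarrow> 'o \<Rightarrow> 'p \<Rightarrow> bool" where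
  "existential_splitting C P A \<alpha> \<longleftrightarrow>
     \<alpha> \<in> Fib P A \<and>
     (\<forall>B\<in>Obj C. \<forall>\<beta>\<in>Fib P (A \<otimes>\<^bsub>C\<^esub> B). Le P A \<alpha> (exq C P (Pr1 C A B) \<beta>) \<longrightarrow>
        (\<exists>g\<in>hom C A B. Le P A \<alpha> (Re P \<langle>Idn C A, g\<rangle>\<^bsub>C\<^esub> \<beta>)))"

definition universal_splitting ::
  "('o, 'm, 'c) fp_category_scheme \<Rightarrow> ('o, 'm, 'p, 'd) doctrine_scheme \<Rightarrow> 'o \<Rightarrow> 'p \<Rightarrow> bool" where
  "universal_splitting C P A \<alpha> \<longleftrightarrow>
     \<alpha> \<in> Fib P A \<and>
     (\<forall>B\<in>Obj C. \<forall>\<beta>\<in>Fib P (A \<otimes>\<^bsub>C\<^esub> B). Le P A (allq C P (Pr1 C A B) \<beta>) \<alpha> \<longrightarrow>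
        (\<exists>g\<in>hom C A B. Le P A (Re P \<langle>Idn C A, g\<rangle>\<^bsub>C\<^esub> \<beta>) \<alpha>))"

definition existential_free ::
  "('o, 'm, 'c) fp_category_scheme \<Rightarrow> ('o, 'm, 'p, 'd) doctrine_scheme \<Rightarrow> 'o \<Rightarrow> 'p \<Rightarrow> bool" where
  "existential_free C P I \<alpha> \<longleftrightarrow>
     \<alpha> \<in> Fib P I \<and> (\<forall>A\<in>Obj C. \<forall>f\<in>hom C A I. existential_splitting C P A (Re P f \<alpha>))"

definition universal_free ::
  "('o, 'm, 'c) fp_category_scheme \<Rightarrow> ('o, 'm, 'p, 'd) doctrine_scheme \<Rightarrow> 'o \<Rightarrow> 'p \<Rightarrow> bool" where
  "universal_free C P I \<alpha> \<longleftrightarrow>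
     \<alpha> \<in> Fib P I \<and> (\<forall>A\<in>Obj C. \<forall>f\<in>hom C A I. universal_splitting C P A (Re P f \<alpha>))"

definition enough_existential_free ::
  "('o, 'm, 'c) fp_category_scheme \<Rightarrow> ('o, 'm, 'p, 'd) doctrine_scheme \<Rightarrow> bool" where
  "enough_existential_free C P \<longleftrightarrow>
     (\<forall>I\<in>Obj C. \<forall>\<alpha>\<in>Fib P I. \<exists>A\<in>Obj C. \<exists>\<beta>.
        existential_free C P (I \<otimes>\<^bsub>C\<^esub> A) \<beta> \<and> \<alpha> = exq C P (Pr1 C I A) \<beta>)"

definition enough_universal_free ::
  "('o, 'm, 'c) fp_category_scheme \<Rightarrow> ('o, 'm, 'p, 'd) doctrine_scheme \<Rightarrow> bool" where
  "enough_universal_free C P \<longleftrightarrow>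
     (\<forall>I\<in>Obj C. \<forall>\<alpha>\<in>Fib P I. \<exists>A\<in>Obj C. \<exists>\<beta>.
        universal_free C P (I \<otimes>\<^bsub>C\<^esub> A) \<beta> \<and> \<alpha> = allq C P (Pr1 C I A) \<beta>)"

text \<open>The subdoctrine \<open>P\<^sup>\<exists>\<^sup>-\<^sup>f\<^sup>r\<^sup>e\<^sup>e\<close>. Applied to it, \<open>allq\<close> is the right adjoint
  between the smaller fibres, which agrees with that of \<open>P\<close> when \<open>P\<close> is a Skolem doctrine.\<close>

definition existential_free_subdoctrine ::
  "('o, 'm, 'c) fp_category_scheme \<Rightarrow> ('o, 'm, 'p, 'd) doctrine_scheme \<Rightarrow> ('o, 'm, 'p, 'd) doctrine_scheme"
  where
  "existential_free_subdoctrine C P = P\<lparr>Fib := \<lambda>A. {\<alpha>. existential_free C P A \<alpha>}\<rparr>"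

locale skolem_doctrine = doctrine C P
  for C :: "('o, 'm, 'c) fp_category_scheme" (structure)
    and P :: "('o, 'm, 'p, 'd) doctrine_scheme" +
  assumes base_cartesian_closed: "cartesian_closed C"
    and existential: "existential C P"
    and universal: "universal C P"
    and enough_existential_free: "enough_existential_free C P"
    and existential_free_allq:
      "\<lbrakk>is_projection C p; existential_free C P (Dom C p) \<alpha>\<rbrakk>
        \<Longrightarrow> existential_free C P (Cod C p) (allq C P p \<alpha>)"

locale goedel_doctrine = skolem_doctrine C P
  for C :: "('o, 'm, 'c) fp_category_scheme" (structure)
    and P :: "('o, 'm, 'p, 'd) doctrine_scheme" +
  assumes enough_universal_free: "enough_universal_free C (existential_free_subdoctrine C P)"

definition quantifier_free ::
  "('o, 'm, 'c) fp_category_scheme \<Rightarrow> ('o, 'm, 'p, 'd) doctrine_scheme \<Rightarrow> 'o \<Rightarrow> 'p \<Rightarrow> bool" where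
  "quantifier_free C P A \<alpha> \<longleftrightarrow>
     existential_free C P A \<alpha> \<and> universal_free C (existential_free_subdoctrine C P) A \<alpha>"

end

theory Submission
  imports Defs
begin

text \<open>Write \<open>a = \<forall>x. \<psi>\<^sub>D\<close>. By adjunction and Beck-Chevalley the left-hand side says
  \<open>a(i,u) \<turnstile> \<exists>v. \<forall>y. \<phi>\<^sub>D(i,v,y)\<close>. Since \<open>a\<close> is existential-free, this holds iff
  \<open>a(i,u) \<turnstile> \<forall>y. \<phi>\<^sub>D(i,f\<^sub>0(i,u),y)\<close> for some \<open>f\<^sub>0\<close>, i.e. iff
  \<open>\<forall>x. \<psi>\<^sub>D(i,u,x) \<turnstile> \<phi>\<^sub>D(i,f\<^sub>0(i,u),y)\<close> in context \<open>i,u,y\<close>. All predicates involved are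
  existential-free, so universal-freeness of \<open>\<phi>\<^sub>D\<close> in the subdoctrine yields \<open>f\<^sub>1\<close>.\<close>

section \<open>Arrows, pairing and products in the base category\<close>

context category
begin

lemma hom_objD:
  assumes "f \<in> hom C A B"
  shows "A \<in> Obj C" "B \<in> Obj C"
  using assms dom_in_obj cod_in_obj by (auto simp: hom_def)

lemma hom_arrD:
  assumes "f \<in> hom C A B"
  shows "f \<in> Arr C" "Dom C f = A" "Cod C f = B"
  using assms by (auto simp: hom_def)

end

context fp_category
begin

lemma ex1_pair:
  assumes "f \<in> hom C Z A" and "g \<in> hom C Z B"
  shows "\<exists>!h. h \<in> hom C Z (A \<otimes> B) \<and> Pr1 C A B \<cdot> h = f \<and> Pr2 C A B \<cdot> h = g"
proof -
  note obj = hom_objD[OF assms(1)] hom_objD[OF assms(2)]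
  have "Dom C (Pr1 C A B) = A \<otimes> B" "Dom C (Pr2 C A B) = A \<otimes> B"
    "Cod C (Pr1 C A B) = A" "Cod C (Pr2 C A B) = B"
    using pr1_in_hom pr2_in_hom obj hom_arrD by metis+
  with is_product_pr[of A B] obj assms show ?thesis
    unfolding is_product_def by simp
qed

lemma pair_props:
  assumes "f \<in> hom C Z A" and "g \<in> hom C Z B"
  shows "\<langle>f, g\<rangle> \<in> hom C Z (A \<otimes> B) \<and> Pr1 C A B \<cdot> \<langle>f, g\<rangle> = f \<and> Pr2 C A B \<cdot> \<langle>f, g\<rangle> = g"
  unfolding pair_def hom_arrD[OF assms(1)] hom_arrD[OF assms(2)]
  by (rule theI'[OF ex1_pair[OF assms]])

lemma pair_in_hom:
  "\<lbrakk>f \<in> hom C Z A; g \<in> hom C Z B\<rbrakk> \<Longrightarrow> \<langle>f, g\<rangle> \<in> hom C Z (A \<otimes> B)"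
  and pr1_pair: "\<lbrakk>f \<in> hom C Z A; g \<in> hom C Z B\<rbrakk> \<Longrightarrow> Pr1 C A B \<cdot> \<langle>f, g\<rangle> = f"
  and pr2_pair: "\<lbrakk>f \<in> hom C Z A; g \<in> hom C Z B\<rbrakk> \<Longrightarrow> Pr2 C A B \<cdot> \<langle>f, g\<rangle> = g"
  using pair_props by blast+

lemma pair_unique:
  assumes "f \<in> hom C Z A" and "g \<in> hom C Z B" and "h \<in> hom C Z (A \<otimes> B)"
    and "Pr1 C A B \<cdot> h = f" and "Pr2 C A B \<cdot> h = g"
  shows "h = \<langle>f, g\<rangle>"
  using ex1_pair[OF assms(1,2)] pair_props[OF assms(1,2)] assms(3-) by blast

lemma pair_comp:
  assumes "f \<in> hom C Z A" and "g \<in> hom C Z B" and "k \<in> hom C W Z"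
  shows "\<langle>f, g\<rangle> \<cdot> k = \<langle>f \<cdot> k, g \<cdot> k\<rangle>"
proof (rule pair_unique)
  note obj = hom_objD[OF assms(1)] hom_objD[OF assms(2)]
  note p = pair_props[OF assms(1,2)]
  show "f \<cdot> k \<in> hom C W A" "g \<cdot> k \<in> hom C W B" "\<langle>f, g\<rangle> \<cdot> k \<in> hom C W (A \<otimes> B)"
    using assms p comp_in_hom by blast+
  show "Pr1 C A B \<cdot> (\<langle>f, g\<rangle> \<cdot> k) = f \<cdot> k"
    using comp_assoc[OF assms(3) _ pr1_in_hom] p obj by metis
  show "Pr2 C A B \<cdot> (\<langle>f, g\<rangle> \<cdot> k) = g \<cdot> k"
    using comp_assoc[OF assms(3) _ pr2_in_hom] p obj by metis
qed

lemma is_projection_pr1: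
  "\<lbrakk>A \<in> Obj C; B \<in> Obj C\<rbrakk> \<Longrightarrow> is_projection C (Pr1 C A B)"
  unfolding is_projection_def using is_product_pr by blast

text \<open>The arrow h \<times> 1_Y from \<open>A \<otimes> Y\<close> to
  \<open>B \<otimes> Y\<close>, for \<open>h\<close> from \<open>A\<close> to \<open>B\<close>.
  Reindexing along it substitutes \<open>h\<close> while keeping the variable of type
  \<open>Y\<close> that is to be quantified.\<close>

definition times_id :: "'m \<Rightarrow> 'o \<Rightarrow> 'o \<Rightarrow> 'm" where
  "times_id h A Y = \<langle>h \<cdot> Pr1 C A Y, Pr2 C A Y\<rangle>"

lemma times_id_props:
  assumes "h \<in> hom C A B" and "Y \<in> Obj C"
  shows "times_id h A Y \<in> hom C (A \<otimes> Y) (B \<otimes> Y)"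
    and "Pr1 C B Y \<cdot> times_id h A Y = h \<cdot> Pr1 C A Y"
    and "Pr2 C B Y \<cdot> times_id h A Y = Pr2 C A Y"
proof -
  have "A \<in> Obj C" using assms hom_objD by blast
  then have "h \<cdot> Pr1 C A Y \<in> hom C (A \<otimes> Y) B" "Pr2 C A Y \<in> hom C (A \<otimes> Y) Y"
    using assms pr1_in_hom pr2_in_hom comp_in_hom by blast+
  then show "times_id h A Y \<in> hom C (A \<otimes> Y) (B \<otimes> Y)"
    and "Pr1 C B Y \<cdot> times_id h A Y = h \<cdot> Pr1 C A Y"
    and "Pr2 C B Y \<cdot> times_id h A Y = Pr2 C A Y"
    unfolding times_id_def using pair_props by blast+
qed

lemma times_id_comp_pair:
  assumes "h \<in> hom C A B" and "k \<in> hom C Z A" and "g \<in> hom C Z Y"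
  shows "times_id h A Y \<cdot> \<langle>k, g\<rangle> = \<langle>h \<cdot> k, g\<rangle>"
proof -
  have obj: "A \<in> Obj C" "Y \<in> Obj C" using assms hom_objD by blast+
  note pr = pr1_in_hom[OF obj] pr2_in_hom[OF obj]
  have kg: "\<langle>k, g\<rangle> \<in> hom C Z (A \<otimes> Y)"
    using assms pair_in_hom by blast
  have "times_id h A Y \<cdot> \<langle>k, g\<rangle> = \<langle>(h \<cdot> Pr1 C A Y) \<cdot> \<langle>k, g\<rangle>, Pr2 C A Y \<cdot> \<langle>k, g\<rangle>\<rangle>"
    unfolding times_id_def by (rule pair_comp[OF comp_in_hom[OF pr(1) assms(1)] pr(2) kg])
  then show ?thesis
    using assms pr1_pair pr2_pair comp_assoc[OF kg pr(1) assms(1)] by simp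
qed

text \<open>The mediating arrow is forced: an arrow \<open>r\<close> into
  \<open>B \<otimes> Y\<close> whose first component is \<open>h \<cdot> k\<close> carries one
  further datum, its second component, so it factors through
  \<open>\<langle>k, Pr2 C B Y \<cdot> r\<rangle>\<close>. Beck-Chevalley is always applied to
  squares of this form.\<close>

lemma is_pullback_times_id:
  assumes h: "h \<in> hom C A B" and Y: "Y \<in> Obj C"
  shows "is_pullback C (Pr1 C B Y) h (times_id h A Y) (Pr1 C A Y)"
proof -
  have obj: "A \<in> Obj C" "B \<in> Obj C" using h hom_objD by blast+
  note prA = pr1_in_hom[OF obj(1) Y] pr2_in_hom[OF obj(1) Y]
  note prB = pr1_in_hom[OF obj(2) Y] pr2_in_hom[OF obj(2) Y]
  note t = times_id_props[OF h Y]
  have univ: "\<exists>!m. m \<in> hom C Z (A \<otimes> Y) \<and> times_id h A Y \<cdot> m = r \<and> Pr1 C A Y \<cdot> m = k"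
    if r: "r \<in> hom C Z (B \<otimes> Y)" and k: "k \<in> hom C Z A" and eq: "Pr1 C B Y \<cdot> r = h \<cdot> k" for Z r k
  proof -
    define g where "g = Pr2 C B Y \<cdot> r"
    have g: "g \<in> hom C Z Y" unfolding g_def using r prB comp_in_hom by blast
    have r_eq: "r = \<langle>h \<cdot> k, g\<rangle>"
      using pair_unique[OF comp_in_hom[OF k h] g r eq] g_def by simp
    show ?thesis
    proof (rule ex1I[of _ "\<langle>k, g\<rangle>"])
      show "\<langle>k, g\<rangle> \<in> hom C Z (A \<otimes> Y) \<and> times_id h A Y \<cdot> \<langle>k, g\<rangle> = r \<and> Pr1 C A Y \<cdot> \<langle>k, g\<rangle> = k"
        using pair_props[OF k g] times_id_comp_pair[OF h k g] r_eq by simp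
    next
      fix m assume m: "m \<in> hom C Z (A \<otimes> Y) \<and> times_id h A Y \<cdot> m = r \<and> Pr1 C A Y \<cdot> m = k"
      then have "Pr2 C A Y \<cdot> m = g"
        using comp_assoc[OF _ t(1) prB(2)] t(3) g_def by metis
      then show "m = \<langle>k, g\<rangle>"
        using pair_unique[OF k g] m by blast
    qed
  qed
  show ?thesis
    unfolding is_pullback_def hom_arrD[OF prA(1)] hom_arrD[OF prB(1)] hom_arrD[OF t(1)] hom_arrD[OF h]
    using univ t(2) hom_arrD(1)[OF h] hom_arrD(1)[OF prA(1)] hom_arrD(1)[OF prB(1)] hom_arrD(1)[OF t(1)]
    by auto
qed

end

section \<open>Quantifiers as adjoints, and Beck-Chevalley\<close>

context doctrine
begin

text \<open>Two left adjoints agree on the fibre over \<open>Dom C p\<close>: each value lies below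
  the other by the adjunction, and antisymmetry applies. Hence the description in \<open>exq\<close>
  denotes the value of any left adjoint.\<close>

lemma exq_adjoint:
  assumes "existential C P" and "is_projection C p"
  shows "is_left_adjoint C P p (exq C P p)"
proof -
  obtain L where L: "is_left_adjoint C P p L"
    using assms unfolding existential_def by blast
  have cod: "Cod C p \<in> Obj C"
    using assms(2) cod_in_obj unfolding is_projection_def is_product_def by blast
  have "exq C P p \<alpha> = L \<alpha>" if \<alpha>: "\<alpha> \<in> Fib P (Dom C p)" for \<alpha>
    unfolding exq_def
  proof (rule the_equality)
    fix \<gamma> assume "\<exists>L. is_left_adjoint C P p L \<and> \<gamma> = L \<alpha>"
    then show "\<gamma> = L \<alpha>"
      using L \<alpha> cod le_refl le_antisym unfolding is_left_adjoint_def by metis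
  qed (use L in blast)
  with L show ?thesis unfolding is_left_adjoint_def by simp
qed

text \<open>Right adjoints are unique on the fibre, again by antisymmetry. Stated for a given
  \<open>R\<close>, so that it also identifies the quantifier of the existential-free subdoctrine
  once a right adjoint is exhibited there.\<close>

lemma allq_eqI:
  assumes "is_right_adjoint C P p R" and "\<alpha> \<in> Fib P (Dom C p)" and "Cod C p \<in> Obj C"
  shows "allq C P p \<alpha> = R \<alpha>"
  unfolding allq_def
proof (rule the_equality)
  fix \<gamma> assume "\<exists>R. is_right_adjoint C P p R \<and> \<gamma> = R \<alpha>"
  then show "\<gamma> = R \<alpha>"
    using assms le_refl le_antisym unfolding is_right_adjoint_def by metis
qed (use assms in blast)

lemma allq_adjoint:
  assumes "universal C P" and "is_projection C p"
  shows "is_right_adjoint C P p (allq C P p)"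
proof -
  obtain R where R: "is_right_adjoint C P p R"
    using assms unfolding universal_def by blast
  have cod: "Cod C p \<in> Obj C"
    using assms(2) cod_in_obj unfolding is_projection_def is_product_def by blast
  with R show ?thesis
    using allq_eqI[OF R] unfolding is_right_adjoint_def by simp
qed

lemma exq_in_fib:
  assumes "existential C P" and "A \<in> Obj C" and "B \<in> Obj C" and "\<alpha> \<in> Fib P (A \<otimes> B)"
  shows "exq C P (Pr1 C A B) \<alpha> \<in> Fib P A"
  using exq_adjoint[OF assms(1) is_projection_pr1[OF assms(2,3)]] assms(4-)
    hom_arrD[OF pr1_in_hom[OF assms(2,3)]]
  unfolding is_left_adjoint_def by simp

lemma exq_le_iff:
  assumes "existential C P" and "A \<in> Obj C" and "B \<in> Obj C" and "\<alpha> \<in> Fib P (A \<otimes> B)" and "\<beta> \<in> Fib P A"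
  shows "Le P A (exq C P (Pr1 C A B) \<alpha>) \<beta> \<longleftrightarrow> Le P (A \<otimes> B) \<alpha> (Re P (Pr1 C A B) \<beta>)"
  using exq_adjoint[OF assms(1) is_projection_pr1[OF assms(2,3)]] assms(4-)
    hom_arrD[OF pr1_in_hom[OF assms(2,3)]]
  unfolding is_left_adjoint_def by simp

lemma allq_in_fib:
  assumes "universal C P" and "A \<in> Obj C" and "B \<in> Obj C" and "\<alpha> \<in> Fib P (A \<otimes> B)"
  shows "allq C P (Pr1 C A B) \<alpha> \<in> Fib P A"
  using allq_adjoint[OF assms(1) is_projection_pr1[OF assms(2,3)]] assms(4-)
    hom_arrD[OF pr1_in_hom[OF assms(2,3)]]
  unfolding is_right_adjoint_def by simp

lemma le_allq_iff:
  assumes "universal C P" and "A \<in> Obj C" and "B \<in> Obj C" and "\<alpha> \<in> Fib P (A \<otimes> B)" and "\<beta> \<in> Fib P A"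
  shows "Le P A \<beta> (allq C P (Pr1 C A B) \<alpha>) \<longleftrightarrow> Le P (A \<otimes> B) (Re P (Pr1 C A B) \<beta>) \<alpha>"
  using allq_adjoint[OF assms(1) is_projection_pr1[OF assms(2,3)]] assms(4-)
    hom_arrD[OF pr1_in_hom[OF assms(2,3)]]
  unfolding is_right_adjoint_def by simp

text \<open>Beck-Chevalley at the pullback of \<open>Pr1 C B Y\<close> along \<open>h\<close>; in
  the internal language, substituting \<open>h\<close> for the free variable passes under the
  quantifier.\<close>

lemma exq_beck_chevalley:
  assumes "existential C P" and "h \<in> hom C A B" and "Y \<in> Obj C" and "\<beta> \<in> Fib P (B \<otimes> Y)"
  shows "Re P h (exq C P (Pr1 C B Y) \<beta>) = exq C P (Pr1 C A Y) (Re P (times_id h A Y) \<beta>)"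
  using assms is_pullback_times_id[OF assms(2,3)] is_projection_pr1 hom_objD[OF assms(2)]
    hom_arrD(2)[OF pr1_in_hom[of B Y]]
  unfolding existential_def by metis

lemma allq_beck_chevalley:
  assumes "universal C P" and "h \<in> hom C A B" and "Y \<in> Obj C" and "\<beta> \<in> Fib P (B \<otimes> Y)"
  shows "Re P h (allq C P (Pr1 C B Y) \<beta>) = allq C P (Pr1 C A Y) (Re P (times_id h A Y) \<beta>)"
  using assms is_pullback_times_id[OF assms(2,3)] is_projection_pr1 hom_objD[OF assms(2)]
    hom_arrD(2)[OF pr1_in_hom[of B Y]]
  unfolding universal_def by metis

section \<open>Witnesses, instances and existential-free predicates\<close>

lemma re_section_pr1:
  assumes "g \<in> hom C A B" and "\<alpha> \<in> Fib P A"
  shows "Re P \<langle>Idn C A, g\<rangle> (Re P (Pr1 C A B) \<alpha>) = \<alpha>"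
proof -
  have obj: "A \<in> Obj C" "B \<in> Obj C" using assms hom_objD by blast+
  note s = pair_props[OF id_in_hom[OF obj(1)] assms(1)]
  show ?thesis
    using re_comp[of "\<langle>Idn C A, g\<rangle>" A "A \<otimes> B" "Pr1 C A B" A \<alpha>] s pr1_in_hom[OF obj] re_id[OF obj(1)] assms(2)
    by simp
qed

text \<open>Reindex the unit of the adjunction along \<open>\<langle>Idn C A, g\<rangle>\<close>.
  This arrow is a section of the projection, so the weakening on the right-hand side
  cancels.\<close>

lemma le_exq_witness:
  assumes "existential C P" and "g \<in> hom C A B" and "\<beta> \<in> Fib P (A \<otimes> B)"
  shows "Le P A (Re P \<langle>Idn C A, g\<rangle> \<beta>) (exq C P (Pr1 C A B) \<beta>)"
proof -
  have obj: "A \<in> Obj C" "B \<in> Obj C" using assms hom_objD by blast+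
  note e = exq_in_fib[OF assms(1) obj assms(3)]
  have "Le P (A \<otimes> B) \<beta> (Re P (Pr1 C A B) (exq C P (Pr1 C A B) \<beta>))"
    using exq_le_iff[OF assms(1) obj assms(3) e] le_refl[OF obj(1) e] by blast
  then show ?thesis
    using re_mono[OF pair_in_hom[OF id_in_hom[OF obj(1)] assms(2)] assms(3)
        re_in_fib[OF pr1_in_hom[OF obj] e]] re_section_pr1[OF assms(2) e] by simp
qed

text \<open>Dually, reindex the counit along the same section.\<close>

lemma allq_le_instance:
  assumes "universal C P" and "g \<in> hom C A B" and "\<beta> \<in> Fib P (A \<otimes> B)"
  shows "Le P A (allq C P (Pr1 C A B) \<beta>) (Re P \<langle>Idn C A, g\<rangle> \<beta>)"
proof -
  have obj: "A \<in> Obj C" "B \<in> Obj C" using assms hom_objD by blast+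
  note e = allq_in_fib[OF assms(1) obj assms(3)]
  have "Le P (A \<otimes> B) (Re P (Pr1 C A B) (allq C P (Pr1 C A B) \<beta>)) \<beta>"
    using le_allq_iff[OF assms(1) obj assms(3) e] le_refl[OF obj(1) e] by blast
  then show ?thesis
    using re_mono[OF pair_in_hom[OF id_in_hom[OF obj(1)] assms(2)]
        re_in_fib[OF pr1_in_hom[OF obj] e] assms(3)] re_section_pr1[OF assms(2) e] by simp
qed

text \<open>The splitting property extracts the witness; conversely, \<open>le_exq_witness\<close>
  and transitivity turn a witness into the existential statement. The main proof obtains
  \<open>f\<^sub>0\<close> from this equivalence.\<close>

lemma existential_splitting_le_exq_iff:
  assumes "existential C P" and "existential_splitting C P A \<alpha>"
    and "A \<in> Obj C" and "B \<in> Obj C" and "\<beta> \<in> Fib P (A \<otimes> B)"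
  shows "Le P A \<alpha> (exq C P (Pr1 C A B) \<beta>) \<longleftrightarrow>
    (\<exists>g\<in>hom C A B. Le P A \<alpha> (Re P \<langle>Idn C A, g\<rangle> \<beta>))" (is "?L \<longleftrightarrow> ?R")
proof
  assume ?L
  with assms show ?R unfolding existential_splitting_def by blast
next
  assume ?R
  then obtain g where g: "g \<in> hom C A B" "Le P A \<alpha> (Re P \<langle>Idn C A, g\<rangle> \<beta>)" by blast
  have "\<alpha> \<in> Fib P A" using assms(2) unfolding existential_splitting_def by blast
  then show ?L
    using le_trans[OF assms(3) _ _ _ g(2) le_exq_witness[OF assms(1) g(1) assms(5)]]
      re_in_fib[OF pair_in_hom[OF id_in_hom g(1)]] exq_in_fib assms by blast
qed

lemma existential_free_in_fib:
  "existential_free C P A \<alpha> \<Longrightarrow> \<alpha> \<in> Fib P A"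
  unfolding existential_free_def by blast

lemma existential_free_splitting:
  assumes "existential_free C P A \<alpha>" and "A \<in> Obj C"
  shows "existential_splitting C P A \<alpha>"
  using assms id_in_hom[of A] re_id[of A \<alpha>] unfolding existential_free_def by metis

text \<open>Reindexing along \<open>f\<close> and then along \<open>g\<close> is reindexing along
  \<open>f \<cdot> g\<close>, so every splitting test for the reindexed predicate is already one for
  \<alpha>.\<close>

lemma existential_free_re:
  assumes "existential_free C P B \<alpha>" and "f \<in> hom C A B"
  shows "existential_free C P A (Re P f \<alpha>)"
proof -
  have "existential_splitting C P Z (Re P g (Re P f \<alpha>))" if "g \<in> hom C Z A" for Z g
    using assms that re_comp[OF that assms(2)] comp_in_hom[OF that assms(2)] hom_objD[OF that]
    unfolding existential_free_def by metis
  then show ?thesis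
    using assms re_in_fib unfolding existential_free_def by blast
qed

end

section \<open>The subdoctrine of existential-free predicates, and quantifier-free
  predicates\<close>

lemma existential_free_subdoctrine_simps [simp]:
  "Fib (existential_free_subdoctrine C P) A = {\<alpha>. existential_free C P A \<alpha>}"
  "Le (existential_free_subdoctrine C P) = Le P"
  "Re (existential_free_subdoctrine C P) = Re P"
  by (simp_all add: existential_free_subdoctrine_def)

context skolem_doctrine
begin

text \<open>The fibres are subsets carrying the order and reindexing of \<open>P\<close>, so the
  laws are inherited; closure under reindexing is \<open>existential_free_re\<close>.\<close>

lemma doctrine_existential_free_subdoctrine: "doctrine C (existential_free_subdoctrine C P)"
proof unfold_locales
qed (auto intro: le_refl le_antisym re_mono re_id re_comp existential_free_re existential_free_in_fib
    elim: le_trans[rotated 4])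

text \<open>By \<open>existential_free_allq\<close> the quantifier of \<open>P\<close> preserves
  existential-freeness, so its adjunction restricts to the smaller fibres, and right adjoints there
  are unique.\<close>

lemma allq_existential_free_subdoctrine:
  assumes "is_projection C p" and "existential_free C P (Dom C p) \<alpha>"
  shows "allq C (existential_free_subdoctrine C P) p \<alpha> = allq C P p \<alpha>"
proof (rule doctrine.allq_eqI[OF doctrine_existential_free_subdoctrine])
  show "is_right_adjoint C (existential_free_subdoctrine C P) p (allq C P p)"
    using allq_adjoint[OF universal assms(1)] existential_free_allq[OF assms(1)] existential_free_in_fib
    unfolding is_right_adjoint_def by simp
  show "Cod C p \<in> Obj C"
    using assms(1) cod_in_obj unfolding is_projection_def is_product_def by blast
qed (use assms in simp)

text \<open>From left to right this is universal-freeness of \<alpha>, tested at the identity arrow.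
  That test ranges over the subdoctrine, which is why \<beta> is taken existential-free. The
  converse instantiates the universal quantifier at \<open>g\<close>.\<close>

lemma quantifier_free_allq_le_iff:
  assumes "quantifier_free C P A \<alpha>" and "existential_free C P (A \<otimes> B) \<beta>"
    and "A \<in> Obj C" and "B \<in> Obj C"
  shows "Le P A (allq C P (Pr1 C A B) \<beta>) \<alpha> \<longleftrightarrow>
    (\<exists>g\<in>hom C A B. Le P A (Re P \<langle>Idn C A, g\<rangle> \<beta>) \<alpha>)" (is "?L \<longleftrightarrow> ?R")
proof
  have "Re P (Idn C A) \<alpha> = \<alpha>"
    using assms re_id existential_free_in_fib unfolding quantifier_free_def by blast
  then have "universal_splitting C (existential_free_subdoctrine C P) A \<alpha>"
    using assms(1,3) id_in_hom[of A] unfolding quantifier_free_def universal_free_def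
    by (metis existential_free_subdoctrine_simps(3))
  moreover assume ?L
  \<comment> \<open>The splitting property speaks of the quantifier of the subdoctrine,
    \<open>?L\<close> of that of \<open>P\<close>.\<close>
  moreover have "allq C (existential_free_subdoctrine C P) (Pr1 C A B) \<beta> = allq C P (Pr1 C A B) \<beta>"
    using allq_existential_free_subdoctrine[OF is_projection_pr1] assms
      hom_arrD(2)[OF pr1_in_hom[of A B]] by simp
  ultimately show ?R
    using assms(2,4) unfolding universal_splitting_def by simp
next
  note \<beta> = existential_free_in_fib[OF assms(2)]
  assume ?R
  then obtain g where g: "g \<in> hom C A B" "Le P A (Re P \<langle>Idn C A, g\<rangle> \<beta>) \<alpha>" by blast
  have "\<alpha> \<in> Fib P A" using assms(1) existential_free_in_fib unfolding quantifier_free_def by blast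
  then show ?L
    using le_trans[OF assms(3) _ _ _ allq_le_instance[OF universal g(1) \<beta>] g(2)]
      re_in_fib[OF pair_in_hom[OF id_in_hom g(1)]] allq_in_fib[OF universal] \<beta> assms by blast
qed

text \<open>Both halves of the notion quantify over all reindexings, so composing with
  \<open>f\<close> stays within the tests for \<alpha>.\<close>

lemma quantifier_free_re:
  assumes "quantifier_free C P B \<alpha>" and "f \<in> hom C A B"
  shows "quantifier_free C P A (Re P f \<alpha>)"
proof -
  have "universal_splitting C (existential_free_subdoctrine C P) Z (Re P g (Re P f \<alpha>))"
    if "g \<in> hom C Z A" for Z g
  proof -
    have "Re P g (Re P f \<alpha>) = Re P (f \<cdot> g) \<alpha>"
      using re_comp[OF that assms(2)] assms(1) existential_free_in_fib
      unfolding quantifier_free_def by simp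
    then show ?thesis
      using assms(1) comp_in_hom[OF that assms(2)] hom_objD[OF that]
      unfolding quantifier_free_def universal_free_def by simp
  qed
  moreover have "existential_free C P A (Re P f \<alpha>)"
    using assms existential_free_re unfolding quantifier_free_def by blast
  ultimately show ?thesis
    unfolding quantifier_free_def universal_free_def by simp
qed

end

section \<open>Extraction of the two Skolem arrows\<close>

theorem theorem3p16:
  fixes C :: "('o, 'm) fp_category" (structure)
    and P :: "('o, 'm, 'p) doctrine"
    and I U X V Y :: 'o
    and \<psi>\<^sub>D \<phi>\<^sub>D :: 'p
  assumes "goedel_doctrine C P"
    and "I \<in> Obj C" and "U \<in> Obj C" and "X \<in> Obj C" and "V \<in> Obj C" and "Y \<in> Obj C"
    and "quantifier_free C P (I \<otimes> U \<otimes> X) \<psi>\<^sub>D"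
    and "quantifier_free C P (I \<otimes> V \<otimes> Y) \<phi>\<^sub>D"
  shows
    "Le P I (exq C P (Pr1 C I U) (allq C P (Pr1 C (I \<otimes> U) X) \<psi>\<^sub>D))
            (exq C P (Pr1 C I V) (allq C P (Pr1 C (I \<otimes> V) Y) \<phi>\<^sub>D)) \<longleftrightarrow>
     (\<exists>f\<^sub>0 \<in> hom C (I \<otimes> U) V. \<exists>f\<^sub>1 \<in> hom C (I \<otimes> U \<otimes> Y) X.
        Le P (I \<otimes> U \<otimes> Y)
          (Re P \<langle>Pr1 C (I \<otimes> U) Y, f\<^sub>1\<rangle> \<psi>\<^sub>D)
          (Re P \<langle>\<langle>Pr1 C I U \<cdot> Pr1 C (I \<otimes> U) Y, f\<^sub>0 \<cdot> Pr1 C (I \<otimes> U) Y\<rangle>, Pr2 C (I \<otimes> U) Y\<rangle> \<phi>\<^sub>D))"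
proof -
  interpret goedel_doctrine C P by fact
  note obj = assms(2-6)
  note ex = existential and un = universal
  define A where "A = I \<otimes> U"
  define W where "W = I \<otimes> V"
  define a where "a = allq C P (Pr1 C A X) \<psi>\<^sub>D"
  define b where "b = allq C P (Pr1 C W Y) \<phi>\<^sub>D"
  have A: "A \<in> Obj C" and W: "W \<in> Obj C" and AY: "A \<otimes> Y \<in> Obj C"
    using obj prod_in_obj by (auto simp: A_def W_def)
  have \<psi>: "existential_free C P (A \<otimes> X) \<psi>\<^sub>D"
    using assms(7) by (simp add: quantifier_free_def A_def)
  have \<phi>: "quantifier_free C P (W \<otimes> Y) \<phi>\<^sub>D"
    using assms(8) by (simp add: W_def)
  note \<psi>_fib = existential_free_in_fib[OF \<psi>]
  have \<phi>_fib: "\<phi>\<^sub>D \<in> Fib P (W \<otimes> Y)"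
    using \<phi> existential_free_in_fib by (simp add: quantifier_free_def)
  \<comment> \<open>Closure of existential-free predicates under universal quantification; it is
    what permits splitting the existential quantifier over \<open>V\<close> below.\<close>
  have a_free: "existential_free C P A a"
    using existential_free_allq[OF is_projection_pr1[OF A obj(3)]] \<psi> hom_arrD[OF pr1_in_hom[OF A obj(3)]]
    by (simp add: a_def)
  note a_fib = existential_free_in_fib[OF a_free]
  have b_fib: "b \<in> Fib P W"
    unfolding b_def by (rule allq_in_fib[OF un W obj(5) \<phi>_fib])
  have p: "Pr1 C I U \<in> hom C A I" and q: "Pr1 C A Y \<in> hom C (A \<otimes> Y) A" "Pr2 C A Y \<in> hom C (A \<otimes> Y) Y"
    using pr1_in_hom pr2_in_hom obj A by (simp_all add: A_def)
  have eb: "exq C P (Pr1 C I V) b \<in> Fib P I"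
    using exq_in_fib[OF ex obj(1,4)] b_fib W_def by simp
  have b_lift: "Re P (times_id (Pr1 C I U) A V) b \<in> Fib P (A \<otimes> V)"
    using re_in_fib[OF times_id_props(1)[OF p obj(4)]] b_fib W_def by simp
  have "Le P I (exq C P (Pr1 C I U) a) (exq C P (Pr1 C I V) b) \<longleftrightarrow>
      Le P A a (Re P (Pr1 C I U) (exq C P (Pr1 C I V) b))"
    using exq_le_iff[OF ex obj(1,2) _ eb] a_fib A_def by simp
  \<comment> \<open>The arrow \<open>times_id (Pr1 C I U) A V\<close> sends (i,u,v) to (i,v), so
    \<open>u\<close> is a dummy variable in the reindexed \<open>b\<close>.\<close>
  also have "\<dots> \<longleftrightarrow> Le P A a (exq C P (Pr1 C A V) (Re P (times_id (Pr1 C I U) A V) b))"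
    using exq_beck_chevalley[OF ex p obj(4)] b_fib W_def by simp
  also have "\<dots> \<longleftrightarrow> (\<exists>f\<^sub>0\<in>hom C A V.
      Le P A a (Re P \<langle>Idn C A, f\<^sub>0\<rangle> (Re P (times_id (Pr1 C I U) A V) b)))"
    by (rule existential_splitting_le_exq_iff[OF ex existential_free_splitting[OF a_free A] A obj(4) b_lift])
  also have "\<dots> \<longleftrightarrow> (\<exists>f\<^sub>0\<in>hom C A V. \<exists>f\<^sub>1\<in>hom C (A \<otimes> Y) X.
      Le P (A \<otimes> Y) (Re P \<langle>Pr1 C A Y, f\<^sub>1\<rangle> \<psi>\<^sub>D)
        (Re P \<langle>\<langle>Pr1 C I U \<cdot> Pr1 C A Y, f\<^sub>0 \<cdot> Pr1 C A Y\<rangle>, Pr2 C A Y\<rangle> \<phi>\<^sub>D))"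
  proof (rule bex_cong[OF refl])
    fix f\<^sub>0 assume f0: "f\<^sub>0 \<in> hom C A V"
    \<comment> \<open>In variables, \<open>h\<close> sends (i,u) to
      \<open>(i, f\<^sub>0(i,u))\<close>, \<open>k\<close> sends (i,u,y) to
      \<open>(i, f\<^sub>0(i,u), y)\<close>, and \<open>n\<close> sends (i,u,y,x) to
      (i,u,x).\<close>
    define h where "h = \<langle>Pr1 C I U, f\<^sub>0\<rangle>"
    have h: "h \<in> hom C A W"
      unfolding h_def W_def by (rule pair_in_hom[OF p f0])
    define k where "k = times_id h A Y"
    note k = times_id_props(1)[OF h obj(5), folded k_def]
    define n where "n = times_id (Pr1 C A Y) (A \<otimes> Y) X"
    note n = times_id_props(1)[OF q(1) obj(3), folded n_def]
    have k_eq: "k = \<langle>\<langle>Pr1 C I U \<cdot> Pr1 C A Y, f\<^sub>0 \<cdot> Pr1 C A Y\<rangle>, Pr2 C A Y\<rangle>"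
      unfolding k_def times_id_def h_def pair_comp[OF p f0 q(1)] ..
    have n_eq: "Re P \<langle>Idn C (A \<otimes> Y), f\<^sub>1\<rangle> (Re P n \<psi>\<^sub>D) = Re P \<langle>Pr1 C A Y, f\<^sub>1\<rangle> \<psi>\<^sub>D"
      if f1: "f\<^sub>1 \<in> hom C (A \<otimes> Y) X" for f\<^sub>1
      using re_comp[OF pair_in_hom[OF id_in_hom[OF AY] f1] n \<psi>_fib]
        times_id_comp_pair[OF q(1) id_in_hom[OF AY] f1] comp_id_right[OF q(1)] n_def by simp
    \<comment> \<open>Choosing \<open>f\<^sub>0(i,u)\<close> for \<open>v\<close> and then
      forgetting the dummy \<open>u\<close> composes to \<open>h\<close>.\<close>
    have "Re P \<langle>Idn C A, f\<^sub>0\<rangle> (Re P (times_id (Pr1 C I U) A V) b) = Re P h b"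
      using re_comp[OF pair_in_hom[OF id_in_hom[OF A] f0] times_id_props(1)[OF p obj(4)]]
        times_id_comp_pair[OF p id_in_hom[OF A] f0] comp_id_right[OF p] b_fib
      by (simp add: h_def W_def)
    also have "\<dots> = allq C P (Pr1 C A Y) (Re P k \<phi>\<^sub>D)"
      unfolding b_def k_def by (rule allq_beck_chevalley[OF un h obj(5) \<phi>_fib])
    finally have "Le P A a (Re P \<langle>Idn C A, f\<^sub>0\<rangle> (Re P (times_id (Pr1 C I U) A V) b)) \<longleftrightarrow>
        Le P (A \<otimes> Y) (Re P (Pr1 C A Y) a) (Re P k \<phi>\<^sub>D)"
      using le_allq_iff[OF un A obj(5) re_in_fib[OF k \<phi>_fib] a_fib] by simp
    \<comment> \<open>Beck-Chevalley along the projection that forgets \<open>y\<close> exhibits the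
      weakened \<open>a\<close> as a universal quantification over \<open>x\<close> again.\<close>
    also have "\<dots> \<longleftrightarrow> Le P (A \<otimes> Y) (allq C P (Pr1 C (A \<otimes> Y) X) (Re P n \<psi>\<^sub>D)) (Re P k \<phi>\<^sub>D)"
      unfolding a_def n_def allq_beck_chevalley[OF un q(1) obj(3) \<psi>_fib] ..
    \<comment> \<open>The right-hand side is a reindexing of \<open>\<phi>\<^sub>D\<close>, hence
      quantifier-free, and the body of the quantifier is a reindexing of
      \<open>\<psi>\<^sub>D\<close>, hence existential-free. The witness may depend on
      \<open>y\<close> because the test takes place over \<open>A \<otimes> Y\<close>.\<close>
    also have "\<dots> \<longleftrightarrow> (\<exists>f\<^sub>1\<in>hom C (A \<otimes> Y) X.
        Le P (A \<otimes> Y) (Re P \<langle>Idn C (A \<otimes> Y), f\<^sub>1\<rangle> (Re P n \<psi>\<^sub>D)) (Re P k \<phi>\<^sub>D))"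
      by (rule quantifier_free_allq_le_iff[OF quantifier_free_re[OF \<phi> k] existential_free_re[OF \<psi> n] AY obj(3)])
    finally show "Le P A a (Re P \<langle>Idn C A, f\<^sub>0\<rangle> (Re P (times_id (Pr1 C I U) A V) b)) \<longleftrightarrow>
      (\<exists>f\<^sub>1\<in>hom C (A \<otimes> Y) X. Le P (A \<otimes> Y) (Re P \<langle>Pr1 C A Y, f\<^sub>1\<rangle> \<psi>\<^sub>D)
        (Re P \<langle>\<langle>Pr1 C I U \<cdot> Pr1 C A Y, f\<^sub>0 \<cdot> Pr1 C A Y\<rangle>, Pr2 C A Y\<rangle> \<phi>\<^sub>D))"
      using n_eq k_eq by simp
  qed
  finally show ?thesis
    unfolding a_def b_def A_def W_def .
qed

end
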